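(* Let $p>3$ be a prime and let $a\in\mathbb Z_p$ with $a\not\equiv 0\pmod p$. Put $t=(a-\langle a\rangle_p)/p$. Then $$\sum_{k=0}^{p-1}\binom ak\binom{-1-a}k\equiv (-1)^{\langle a\rangle_p}+(a-\langle a\rangle_p)(p+a-\langle a\rangle_p)E_{p-3}(-a)\pmod{p^3},$$ and also $$\sum_{k=0}^{p-1}\binom ak\binom{-1-a}k\equiv (-1)^{\langle a\rangle_p}+(a-\langle a\rangle_p)(p+a-\langle a\rangle_p)\Big(\frac 2{a^2}-E_{p-3}(a)\Big)\pmod{p^3}.$$ (Note $(a-\langle a\rangle_p)(p+a-\langle a\rangle_p)=p^2t(t+1)$.)
   Context: $\mathbb Z_p$ denotes the set of rational numbers whose denominator is not divisible by $p$ (rational $p$-adic integers). For $x,y\in\mathbb Q$, $x\equiv y\pmod{p^m}$ means $(x-y)/p^m\in\mathbb Z_p$. For $a\in\mathbb Z_p$, $\langle a\rangle_p\in\{0,1,\ldots,p-1\}$ is defined by $a\equiv\langle a\rangle_p\pmod p$. For a rational $a$ and integer $k\ge0$, $\binom ak=a(a-1)\cdots(a-k+1)/k!$. The Euler numbers are defined by $E_0=1$, $E_n=-\sum_{k=1}^{[n/2]}\binom n{2k}E_{n-2k}$ for $n\ge1$, and the Euler polynomials by $E_n(x)=\frac1{2^n}\sum_{k=0}^n\binom nk(2x-1)^{n-k}E_k$. *)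

theory Defs
  imports "HOL-Computational_Algebra.Primes" Complex_Main
begin

definition p_integral :: "nat \<Rightarrow> rat set" where
  "p_integral p = {x. \<not> int p dvd snd (quotient_of x)}"

text \<open>Congruence of rationals modulo \<open>p\<^sup>m\<close>; the arguments need not be \<open>p\<close>-integral.\<close>

definition rat_cong :: "nat \<Rightarrow> nat \<Rightarrow> rat \<Rightarrow> rat \<Rightarrow> bool" where
  "rat_cong p m x y \<longleftrightarrow> (x - y) / of_nat p ^ m \<in> p_integral p"

text \<open>The least residue of \<open>a\<close> modulo \<open>p\<close>, meaningful for \<open>p\<close> prime and \<open>a\<close> \<open>p\<close>-integral
  (see \<open>p_residue_exists1\<close>).\<close>

definition p_residue :: "nat \<Rightarrow> rat \<Rightarrow> nat" where
  "p_residue p a = (THE r. r \<in> {0..p-1} \<and> rat_cong p 1 a (of_nat r))"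

lemma p_integral_iff:
  assumes "prime p"
  shows "x \<in> p_integral p \<longleftrightarrow> (\<exists>u v. x = of_int u / of_int v \<and> \<not> int p dvd v)"
proof
  assume "x \<in> p_integral p"
  then show "\<exists>u v. x = of_int u / of_int v \<and> \<not> int p dvd v"
    by (metis (mono_tags, lifting) mem_Collect_eq p_integral_def prod.collapse quotient_of_div)
next
  assume "\<exists>u v. x = of_int u / of_int v \<and> \<not> int p dvd v"
  then obtain u v where x: "x = of_int u / of_int v" and v: "\<not> int p dvd v" by blast
  obtain c d where cd: "quotient_of x = (c, d)" by force
  have d: "d > 0" "coprime c d" "x = of_int c / of_int d"
    using cd quotient_of_denom_pos quotient_of_coprime quotient_of_div by blast+
  have "v \<noteq> 0" using v by auto
  then have "(of_int (u * d) :: rat) = of_int (c * v)"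
    using x d by (simp add: field_simps)
  then have "u * d = c * v" by (simp only: of_int_eq_iff)
  then have "d dvd c * v" by (metis dvd_triv_right)
  then have "d dvd v" using d(2) by (simp add: coprime_commute coprime_dvd_mult_right_iff)
  then show "x \<in> p_integral p" using v cd unfolding p_integral_def
    by (auto dest: dvd_trans)
qed

lemma p_residue_exists1:
  assumes "prime p" "a \<in> p_integral p"
  shows "\<exists>!r. r \<in> {0..p-1} \<and> rat_cong p 1 a (of_nat r)"
proof -
  obtain u v where a: "a = of_int u / of_int v" and v: "\<not> int p dvd v"
    using assms p_integral_iff by blast
  have p0: "p > 0" using assms(1) prime_gt_0_nat by blast
  have v0: "v \<noteq> 0" using v by auto
  have cong: "rat_cong p 1 a (of_nat r) \<longleftrightarrow> int p dvd u - int r * v" for r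
  proof
    assume "rat_cong p 1 a (of_nat r)"
    then obtain c d where cd: "(a - of_nat r) / of_nat p = of_int c / of_int d" "\<not> int p dvd d"
      using assms(1) by (auto simp: rat_cong_def p_integral_iff)
    have "d \<noteq> 0" using cd by auto
    then have "(of_int ((u - int r * v) * d) :: rat) = of_int (int p * (c * v))"
      using cd(1) a p0 v0 by (simp add: field_simps)
    then have "(u - int r * v) * d = int p * (c * v)" by (simp only: of_int_eq_iff)
    then have "int p dvd (u - int r * v) * d" by simp
    then show "int p dvd u - int r * v"
      using cd(2) assms(1) by (simp add: prime_dvd_mult_iff)
  next
    assume "int p dvd u - int r * v"
    then obtain k where "u - int r * v = int p * k" by (auto simp: dvd_def)
    then have "(of_int u :: rat) - of_nat r * of_int v = of_nat p * of_int k"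
      by (metis of_int_diff of_int_mult of_int_of_nat_eq)
    then have "(a - of_nat r) / of_nat p = of_int k / of_int v"
      using a p0 v0 by (simp add: field_simps)
    then show "rat_cong p 1 a (of_nat r)"
      using v assms(1) by (auto simp: rat_cong_def p_integral_iff)
  qed
  have cop: "coprime v (int p)" using v assms(1)
    by (metis coprime_commute prime_imp_coprime prime_nat_int_transfer)
  then obtain s t where st: "s * v + t * int p = 1"
    using bezout_int[of v "int p"] by auto
  define r where "r = nat ((u * s) mod int p)"
  have r: "int r = (u * s) mod int p" using p0 by (simp add: r_def)
  have "r < p" using r p0 by (metis of_nat_0_less_iff of_nat_less_iff pos_mod_bound)
  moreover have "int p dvd u - int r * v"
  proof -
    have "u - int r * v = u * (s * v + t * int p) - (u * s - int p * ((u * s) div int p)) * v"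
      by (simp add: st r minus_mult_div_eq_mod [symmetric])
    also have "\<dots> = int p * (u * t + ((u * s) div int p) * v)" by (simp add: algebra_simps)
    finally show ?thesis by simp
  qed
  moreover have "r1 = r2" if "r1 < p" "r2 < p" "int p dvd u - int r1 * v" "int p dvd u - int r2 * v"
    for r1 r2
  proof -
    have "int p dvd (u - int r2 * v) - (u - int r1 * v)" using that by (blast intro: dvd_diff)
    then have "int p dvd (int r1 - int r2) * v" by (simp add: algebra_simps)
    then have "int p dvd int r1 - int r2" using v assms(1) by (simp add: prime_dvd_mult_iff)
    then show ?thesis using that(1,2)
      by (metis mod_eq_dvd_iff mod_pos_pos_trivial of_nat_0_le_iff of_nat_eq_iff of_nat_less_iff)
  qed
  ultimately show ?thesis unfolding cong using p0 by (intro ex1I[of _ r]) auto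
qed

function euler_num :: "nat \<Rightarrow> int" where
  "euler_num n = (if n = 0 then 1
     else - (\<Sum>k=1..n div 2. of_nat (n choose (2 * k)) * euler_num (n - 2 * k)))"
  by auto
termination by (relation "measure id") auto

text \<open>Unfolding this unrestricted equation would make the simplifier loop.\<close>

declare euler_num.simps [simp del]

definition euler_polynomial :: "nat \<Rightarrow> rat \<Rightarrow> rat" where
  "euler_polynomial n x =
     1 / 2 ^ n * (\<Sum>k=0..n. of_nat (n choose k) * (2 * x - 1) ^ (n - k) * of_int (euler_num k))"

end

(* Writing S(a) for the binomial sum, S(a) + S(a - 1) telescopes to twice the product of
   1 - a^2/i^2 over 0 < i < p. If a is congruent to r <> 0 modulo p, the factors i = r and
   i = p - r contain D = (a - r)(p + a - r), which is divisible by p^2, and the product is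
   congruent to D/a^2 modulo p^3. Replacing (a, r) by (a - 1, r - 1) leaves D unchanged, and
   E_n(x + 1) + E_n(x) = 2 x^n with n = p - 3 and Fermat's theorem show that
   (-1)^r + D E_{p-3}(-a) obeys the same recurrence. Induction on r reduces the claim to
   r = 0, where Wolstenholme's congruences give S(a) = 1 modulo p^3 and E_{p-3}(0) = 0.
   The second form follows from E_{p-3}(-a) = E_{p-3}(1 + a). *)

theory Submission
  imports Defs "HOL-Number_Theory.Residues"
begin

section \<open>The recurrence for the binomial sum\<close>

text \<open>Up to sign the numerators consist of a - i for 0 \<le> i \<le> k and a + i for 1 \<le> i
  \<le> k + 1. Pairing equal values of i gives the factors \<open>1 - a ^ 2 / i ^ 2\<close>; only
  \<open>a\<close> and \<open>a + (k + 1)\<close> stay unpaired.\<close>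

lemma gchoose_mult_gchoose:
  fixes a :: "'a :: field_char_0"
  shows "(a gchoose Suc k) * ((-1 - a) gchoose Suc k)
    = - (a * (a + of_nat (Suc k)) / of_nat (Suc k) ^ 2) * (\<Prod>i=1..k. 1 - a ^ 2 / of_nat i ^ 2)"
proof (induction k)
  case 0
  show ?case by (simp add: algebra_simps)
next
  case (Suc k)
  let ?P = "\<lambda>k. \<Prod>i=1..k. 1 - a ^ 2 / of_nat i ^ 2"
  have nz: "(of_nat (Suc k) :: 'a) \<noteq> 0" "(of_nat (Suc (Suc k)) :: 'a) \<noteq> 0"
    by (simp_all only: of_nat_eq_0_iff)
  have rec: "(b gchoose Suc (Suc k)) = (b gchoose Suc k) * ((b - of_nat (Suc k)) / of_nat (Suc (Suc k)))"
    for b :: 'a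
    using gbinomial_mult_1[of b "Suc k"] nz by (simp add: field_simps del: of_nat_Suc)
  have "(a gchoose Suc (Suc k)) * ((-1 - a) gchoose Suc (Suc k))
    = (a gchoose Suc k) * ((-1 - a) gchoose Suc k)
      * ((a - of_nat (Suc k)) / of_nat (Suc (Suc k)) * ((-1 - a - of_nat (Suc k)) / of_nat (Suc (Suc k))))"
    unfolding rec by (simp only: mult_ac)
  also have "\<dots> = - (a * (a + of_nat (Suc (Suc k))) / of_nat (Suc (Suc k)) ^ 2)
     * (?P k * (1 - a ^ 2 / of_nat (Suc k) ^ 2))"
  proof -
    \<comment> \<open>The new factor of the second coefficient is -(a + y). The old unpaired factor
      a + x now meets a - x and completes the pair for i = x.\<close>
    define x y P where "x = (of_nat (Suc k) :: 'a)" and "y = (of_nat (Suc (Suc k)) :: 'a)" and "P = ?P k"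
    have y: "-1 - a - x = - (a + y)" by (simp add: x_def y_def)
    show ?thesis
      unfolding Suc.IH x_def[symmetric] y_def[symmetric] P_def[symmetric] y
      using nz[folded x_def y_def] by (simp add: divide_simps) (simp add: algebra_simps power2_eq_square)
  qed
  finally show ?case by simp
qed

text \<open>With x = n + 1, the new terms of both sums are multiples of the same product P. Their
  linear parts cancel, leaving -2 a^2 / x^2 times P, which is exactly the increment of the
  right-hand side.\<close>

lemma sum_gchoose_recurrence:
  fixes a :: "'a :: field_char_0"
  shows "(\<Sum>k=0..n. (a gchoose k) * ((-1 - a) gchoose k))
     + (\<Sum>k=0..n. ((a - 1) gchoose k) * ((-1 - (a - 1)) gchoose k))
    = 2 * (\<Prod>i=1..n. 1 - a ^ 2 / of_nat i ^ 2)"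
proof (induction n)
  case 0
  show ?case by simp
next
  case (Suc n)
  let ?P = "\<Prod>i=1..n. 1 - a ^ 2 / of_nat i ^ 2"
  define x where "x = (of_nat (Suc n) :: 'a)"
  have x: "x \<noteq> 0" unfolding x_def by (simp only: of_nat_eq_0_iff)
  \<comment> \<open>Swapping the two coefficients turns the pair (a - 1, -a) into (-a, -1 - (-a)),
    so the closed form applies at -a; its product is even in a.\<close>
  have "((a - 1) gchoose Suc n) * ((-1 - (a - 1)) gchoose Suc n)
     = (- a gchoose Suc n) * ((-1 - (- a)) gchoose Suc n)"
    by (simp add: mult.commute)
  also have "\<dots> = (a * (x - a) / x ^ 2) * ?P"
    unfolding gchoose_mult_gchoose x_def[symmetric] by simp
  finally have "(a gchoose Suc n) * ((-1 - a) gchoose Suc n)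
     + ((a - 1) gchoose Suc n) * ((-1 - (a - 1)) gchoose Suc n)
     = - 2 * (a ^ 2 / x ^ 2) * ?P"
    unfolding gchoose_mult_gchoose x_def[symmetric]
    using x by (simp add: divide_simps) (simp add: algebra_simps power2_eq_square)
  note step = this
  let ?S = "\<lambda>a. \<Sum>k=0..n. (a gchoose k) * ((-1 - a) gchoose k)"
  have "(?S a + (a gchoose Suc n) * ((-1 - a) gchoose Suc n))
      + (?S (a - 1) + ((a - 1) gchoose Suc n) * ((-1 - (a - 1)) gchoose Suc n))
    = 2 * ?P + - 2 * (a ^ 2 / x ^ 2) * ?P"
    unfolding Suc.IH[symmetric] step[symmetric] by (simp only: add_ac)
  also have "\<dots> = 2 * (?P * (1 - a ^ 2 / x ^ 2))"
    by (simp add: algebra_simps)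
  finally show ?case
    by (simp add: x_def mult.commute[of "prod _ _"] del: of_nat_Suc)
qed

section \<open>Euler polynomials\<close>

lemma euler_num_odd: "odd n \<Longrightarrow> euler_num n = 0"
proof (induction n rule: less_induct)
  case (less n)
  have "n > 0" using less.prems by (rule odd_pos)
  then have "euler_num n = - (\<Sum>k=1..n div 2. of_nat (n choose (2 * k)) * euler_num (n - 2 * k))"
    by (simp add: euler_num.simps[of n])
  also have "(\<Sum>k=1..n div 2. of_nat (n choose (2 * k)) * euler_num (n - 2 * k)) = 0"
    using less by (intro sum.neutral) auto
  finally show ?case by simp
qed

text \<open>Coefficient form of E(t) (e^t + e^(-t)) = 2 for the exponential generating function E of
  the Euler numbers. The factor \<open>1 + (-1) ^ (n - k)\<close> doubles the terms with n - k even
  and kills the others, so the sum is twice the defining recursion.\<close>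

lemma euler_num_sum:
  "(\<Sum>k=0..n. of_nat (n choose k) * (1 + (-1) ^ (n - k)) * (of_int (euler_num k) :: rat))
     = (if n = 0 then 2 else 0)"
proof (cases "n = 0")
  case True
  then show ?thesis by (simp add: euler_num.simps[of 0])
next
  case False
  let ?f = "\<lambda>k. of_nat (n choose k) * (1 + (-1) ^ (n - k)) * (of_int (euler_num k) :: rat)"
  have "(\<Sum>k=0..n. ?f k) = (\<Sum>k\<in>(\<lambda>k. n - 2 * k) ` {0..n div 2}. ?f k)"
  proof (intro sum.mono_neutral_right ballI)
    fix k assume k: "k \<in> {0..n} - (\<lambda>k. n - 2 * k) ` {0..n div 2}"
    have "odd (n - k)"
    proof
      assume "even (n - k)"
      then obtain m where "n - k = 2 * m" by blast
      with k have "k = n - 2 * m" "m \<in> {0..n div 2}" by auto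
      with k show False by blast
    qed
    then show "?f k = 0" by simp
  qed auto
  also have "\<dots> = (\<Sum>k=0..n div 2. ?f (n - 2 * k))"
    by (subst sum.reindex) (auto simp: inj_on_def)
  also have "\<dots> = (\<Sum>k=0..n div 2. 2 * of_int (of_nat (n choose (2 * k)) * euler_num (n - 2 * k)))"
  proof (intro sum.cong refl)
    fix k assume k: "k \<in> {0..n div 2}"
    then have "2 * k \<le> n" by auto
    then have "n choose (n - 2 * k) = n choose (2 * k)" "n - (n - 2 * k) = 2 * k"
      using binomial_symmetric by (metis, simp)
    then show "?f (n - 2 * k) = 2 * of_int (of_nat (n choose (2 * k)) * euler_num (n - 2 * k))"
      by simp
  qed
  also have "\<dots> = 2 * of_int (\<Sum>k=0..n div 2. of_nat (n choose (2 * k)) * euler_num (n - 2 * k))"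
    by (simp only: sum_distrib_left of_int_sum)
  \<comment> \<open>The term k = 0 is \<open>euler_num n\<close> itself, which by definition is
    minus the sum of the others.\<close>
  also have "(\<Sum>k=0..n div 2. of_nat (n choose (2 * k)) * euler_num (n - 2 * k)) = 0"
    using False by (simp add: sum.atLeast_Suc_atMost euler_num.simps[of n])
  finally show ?thesis using False by simp
qed

text \<open>With y = 2x the two values are sums over powers of y + 1 and y - 1. Collecting the
  coefficient of y^m leaves the sum of \<open>euler_num_sum\<close> for n - m, which vanishes unless
  m = n.\<close>

lemma euler_polynomial_shift: "euler_polynomial n (x + 1) + euler_polynomial n x = 2 * x ^ n"
proof -
  define y where "y = 2 * x"
  let ?e = "\<lambda>k. of_int (euler_num k) :: rat"
  have expand: "of_nat (n choose k) * ((y + 1) ^ (n - k) + (y - 1) ^ (n - k)) * ?e k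
     = (\<Sum>m=0..n - k. of_nat (n choose m) * y ^ m * (of_nat ((n - m) choose k) * (1 + (-1) ^ (n - m - k)) * ?e k))"
    if "k \<le> n" for k
  proof -
    \<comment> \<open>Both sides count the choices of disjoint subsets of sizes k and m among n
      elements.\<close>
    have "(n choose k) * ((n - k) choose m) = (n choose m) * ((n - m) choose k)"
      if "m \<le> n - k" for m
      using choose_mult[of k "m + k" n] choose_mult[of m "m + k" n] that \<open>k \<le> n\<close>
        binomial_symmetric[of k "m + k"] by simp
    then have swap: "of_nat (n choose k) * of_nat ((n - k) choose m) = of_nat (n choose m) * (of_nat ((n - m) choose k) :: rat)"
      if "m \<le> n - k" for m
      using that by (metis of_nat_mult)
    have "(y + 1) ^ (n - k) + (y - 1) ^ (n - k)
       = (\<Sum>m=0..n - k. of_nat ((n - k) choose m) * y ^ m * (1 + (-1) ^ (n - k - m)))"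
      using binomial_ring[of y 1 "n - k"] binomial_ring[of y "-1" "n - k"]
      by (simp add: sum.distrib algebra_simps atLeast0AtMost)
    moreover have "of_nat (n choose k) * (of_nat ((n - k) choose m) * y ^ m * (1 + (-1) ^ (n - k - m))) * ?e k
       = of_nat (n choose m) * y ^ m * (of_nat ((n - m) choose k) * (1 + (-1) ^ (n - m - k)) * ?e k)"
      if "m \<in> {0..n - k}" for m
    proof -
      have "of_nat (n choose k) * (of_nat ((n - k) choose m) * y ^ m * (1 + (-1) ^ (n - k - m))) * ?e k
         = (of_nat (n choose k) * of_nat ((n - k) choose m)) * (y ^ m * (1 + (-1) ^ (n - m - k)) * ?e k)"
        by (simp only: mult_ac diff_commute[of n k])
      also have "of_nat (n choose k) * of_nat ((n - k) choose m)
         = (of_nat (n choose m) * of_nat ((n - m) choose k) :: rat)"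
        by (rule swap) (use that in simp)
      finally show ?thesis by (simp only: mult_ac)
    qed
    ultimately show ?thesis
      by (simp only: sum_distrib_left sum_distrib_right cong: sum.cong)
  qed
  have "2 ^ n * (euler_polynomial n (x + 1) + euler_polynomial n x)
    = (\<Sum>k=0..n. of_nat (n choose k) * ((y + 1) ^ (n - k) + (y - 1) ^ (n - k)) * ?e k)"
    by (simp add: euler_polynomial_def y_def algebra_simps sum.distrib)
  also have "\<dots> = (\<Sum>k=0..n. \<Sum>m=0..n - k. of_nat (n choose m) * y ^ m * (of_nat ((n - m) choose k) * (1 + (-1) ^ (n - m - k)) * ?e k))"
    by (intro sum.cong refl expand) auto
  \<comment> \<open>The region k + m \<le> n is symmetric, so the order of summation may be
    exchanged.\<close>
  also have "\<dots> = (\<Sum>m=0..n. \<Sum>k=0..n - m. of_nat (n choose m) * y ^ m * (of_nat ((n - m) choose k) * (1 + (-1) ^ (n - m - k)) * ?e k))"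
    unfolding sum.Sigma[OF finite_atLeastAtMost ballI[OF finite_atLeastAtMost]]
    by (intro sum.reindex_bij_witness[of _ prod.swap prod.swap]) auto
  also have "\<dots> = (\<Sum>m=0..n. of_nat (n choose m) * y ^ m * (if n - m = 0 then 2 else 0))"
    by (simp only: sum_distrib_left[symmetric] euler_num_sum)
  also have "\<dots> = (\<Sum>m\<in>{n}. of_nat (n choose m) * y ^ m * (if n - m = 0 then 2 else 0))"
    by (intro sum.mono_neutral_right) auto
  finally have "2 ^ n * (euler_polynomial n (x + 1) + euler_polynomial n x) = 2 ^ n * (2 * x ^ n)"
    by (simp add: y_def power_mult_distrib)
  then show ?thesis by simp
qed

text \<open>The substitution negates 2x - 1. Since odd Euler numbers vanish and n is even, only even
  powers of 2x - 1 occur.\<close>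

lemma euler_polynomial_reflect:
  assumes "even n"
  shows "euler_polynomial n (1 - x) = euler_polynomial n x"
proof -
  let ?f = "\<lambda>y k. of_nat (n choose k) * y ^ (n - k) * (of_int (euler_num k) :: rat)"
  have "?f (2 * (1 - x) - 1) k = ?f (2 * x - 1) k" if "k \<in> {0..n}" for k
  proof (cases "odd k")
    case False
    then have "even (n - k)" using assms by simp
    moreover have "2 * (1 - x) - 1 = - (2 * x - 1)" by simp
    ultimately show ?thesis by (metis power_minus_even)
  qed (simp add: euler_num_odd)
  then show ?thesis unfolding euler_polynomial_def
    by (intro arg_cong[of _ _ "(*) (1 / 2 ^ n)"] sum.cong refl)
qed

text \<open>The shift identity at 0 gives E_n(1) + E_n(0) = 0, while reflection gives E_n(1) =
  E_n(0).\<close>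

lemma euler_polynomial_0:
  assumes "even n" "n > 0"
  shows "euler_polynomial n 0 = 0"
  using euler_polynomial_shift[of n 0] euler_polynomial_reflect[OF assms(1), of 0] assms(2)
  by (simp add: power_0_left)

section \<open>Rational \<open>p\<close>-adic integers and congruences\<close>

context
  fixes p :: nat
  assumes prime_p: "prime p"
begin

section \<open>The ring of p-integral rationals\<close>

lemma p_integralI: "x = of_int u / of_int v \<Longrightarrow> \<not> int p dvd v \<Longrightarrow> x \<in> p_integral p"
  using p_integral_iff[OF prime_p] by blast

lemma p_integral_of_int: "of_int n \<in> p_integral p"
  using prime_p by (intro p_integralI[of _ n 1]) (auto simp: zdvd1_eq)

lemma p_integral_of_nat: "of_nat n \<in> p_integral p"
  using p_integral_of_int[of "int n"] by simp

lemma p_integral_numeral: "numeral n \<in> p_integral p"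
  using p_integral_of_int[of "numeral n"] by simp

lemma p_integral_0: "0 \<in> p_integral p"
  using p_integral_of_int[of 0] by simp

lemma p_integral_1: "1 \<in> p_integral p"
  using p_integral_of_int[of 1] by simp

lemma p_integral_inverse_of_int:
  assumes "\<not> int p dvd n"
  shows "1 / of_int n \<in> p_integral p"
  using assms by (intro p_integralI[of _ 1 n]) auto

lemma p_integral_inverse_of_nat:
  assumes "\<not> p dvd n"
  shows "1 / of_nat n \<in> p_integral p"
  using p_integral_inverse_of_int[of "int n"] assms by simp

lemma p_integral_add:
  assumes "x \<in> p_integral p" "y \<in> p_integral p"
  shows "x + y \<in> p_integral p"
proof -
  obtain u v where x: "x = of_int u / of_int v" "\<not> int p dvd v"
    using assms(1) p_integral_iff[OF prime_p] by blast
  obtain u' v' where y: "y = of_int u' / of_int v'" "\<not> int p dvd v'"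
    using assms(2) p_integral_iff[OF prime_p] by blast
  have "v \<noteq> 0" "v' \<noteq> 0" using x(2) y(2) by auto
  then have "x + y = of_int (u * v' + u' * v) / of_int (v * v')"
    using x y by (simp add: field_simps)
  then show ?thesis
    using x(2) y(2) prime_p
    by (intro p_integralI[of _ "u * v' + u' * v" "v * v'"]) (auto simp: prime_dvd_mult_iff)
qed

lemma p_integral_mult:
  assumes "x \<in> p_integral p" "y \<in> p_integral p"
  shows "x * y \<in> p_integral p"
proof -
  obtain u v where x: "x = of_int u / of_int v" "\<not> int p dvd v"
    using assms(1) p_integral_iff[OF prime_p] by blast
  obtain u' v' where y: "y = of_int u' / of_int v'" "\<not> int p dvd v'"
    using assms(2) p_integral_iff[OF prime_p] by blast
  have "x * y = of_int (u * u') / of_int (v * v')"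
    using x y by simp
  then show ?thesis
    using x(2) y(2) prime_p
    by (intro p_integralI[of _ "u * u'" "v * v'"]) (auto simp: prime_dvd_mult_iff)
qed

lemma p_integral_uminus: "x \<in> p_integral p \<Longrightarrow> - x \<in> p_integral p"
  using p_integral_mult[OF p_integral_of_int[of "-1"]] by simp

lemma p_integral_diff: "x \<in> p_integral p \<Longrightarrow> y \<in> p_integral p \<Longrightarrow> x - y \<in> p_integral p"
  using p_integral_add[OF _ p_integral_uminus] by fastforce

lemma p_integral_power: "x \<in> p_integral p \<Longrightarrow> x ^ n \<in> p_integral p"
  by (induction n) (auto intro: p_integral_1 p_integral_mult)

lemma p_integral_sum: "(\<And>i. i \<in> A \<Longrightarrow> f i \<in> p_integral p) \<Longrightarrow> sum f A \<in> p_integral p"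
  by (induction A rule: infinite_finite_induct) (auto intro: p_integral_0 p_integral_add)

lemma p_integral_prod: "(\<And>i. i \<in> A \<Longrightarrow> f i \<in> p_integral p) \<Longrightarrow> prod f A \<in> p_integral p"
  by (induction A rule: infinite_finite_induct) (auto intro: p_integral_1 p_integral_mult)

lemmas p_integral_intros =
  p_integral_of_int p_integral_of_nat p_integral_numeral p_integral_0 p_integral_1
  p_integral_add p_integral_mult p_integral_uminus p_integral_diff p_integral_power
  p_integral_sum p_integral_prod

section \<open>Congruences modulo powers of p\<close>

lemma rat_cong_iff: "rat_cong p m x y \<longleftrightarrow> (\<exists>z \<in> p_integral p. x = y + of_nat p ^ m * z)"
proof -
  have "(of_nat p :: rat) ^ m \<noteq> 0" using prime_p by (simp add: prime_gt_0_nat)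
  then have "(x - y) / of_nat p ^ m = z \<longleftrightarrow> x = y + of_nat p ^ m * z" for z
    by (auto simp: field_simps)
  then show ?thesis unfolding rat_cong_def by metis
qed

lemma rat_congI: "z \<in> p_integral p \<Longrightarrow> x = y + of_nat p ^ m * z \<Longrightarrow> rat_cong p m x y"
  using rat_cong_iff by blast

lemma rat_cong_refl: "rat_cong p m x x"
  by (rule rat_congI[OF p_integral_0]) simp

lemma rat_cong_add:
  assumes "rat_cong p m x y" "rat_cong p m x' y'"
  shows "rat_cong p m (x + x') (y + y')"
proof -
  obtain z z' where "z \<in> p_integral p" "z' \<in> p_integral p"
    "x = y + of_nat p ^ m * z" "x' = y' + of_nat p ^ m * z'"
    using assms rat_cong_iff by metis
  then show ?thesis
    by (intro rat_congI[of "z + z'"]) (auto intro: p_integral_intros simp: algebra_simps)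
qed

lemma rat_cong_mult_left:
  assumes "c \<in> p_integral p" "rat_cong p m x y"
  shows "rat_cong p m (c * x) (c * y)"
proof -
  obtain z where "z \<in> p_integral p" "x = y + of_nat p ^ m * z"
    using assms rat_cong_iff by metis
  then show ?thesis
    using assms(1) by (intro rat_congI[of "c * z"]) (auto intro: p_integral_intros simp: algebra_simps)
qed

lemma rat_cong_uminus: "rat_cong p m x y \<Longrightarrow> rat_cong p m (- x) (- y)"
  using rat_cong_mult_left[OF p_integral_of_int[of "-1"]] by simp

lemma rat_cong_diff:
  "rat_cong p m x y \<Longrightarrow> rat_cong p m x' y' \<Longrightarrow> rat_cong p m (x - x') (y - y')"
  using rat_cong_add[OF _ rat_cong_uminus] by fastforce

lemma rat_cong_sym:
  assumes "rat_cong p m x y"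
  shows "rat_cong p m y x"
proof -
  obtain z where "z \<in> p_integral p" "x = y + of_nat p ^ m * z"
    using assms rat_cong_iff by metis
  then show ?thesis
    by (intro rat_congI[of "- z"] p_integral_uminus) simp_all
qed

lemma rat_cong_trans [trans]: "rat_cong p m x y \<Longrightarrow> rat_cong p m y z \<Longrightarrow> rat_cong p m x z"
  using rat_cong_diff[OF rat_cong_add rat_cong_refl, of m x y y z y] by simp

lemma rat_cong_mult:
  assumes "rat_cong p m x y" "rat_cong p m x' y'" "x' \<in> p_integral p" "y \<in> p_integral p"
  shows "rat_cong p m (x * x') (y * y')"
proof -
  have "rat_cong p m (x' * x) (x' * y)" using assms by (intro rat_cong_mult_left)
  moreover have "rat_cong p m (y * x') (y * y')" using assms by (intro rat_cong_mult_left)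
  ultimately show ?thesis
    using rat_cong_trans by (simp add: mult.commute)
qed

lemma rat_cong_power:
  assumes "rat_cong p m x y" "x \<in> p_integral p" "y \<in> p_integral p"
  shows "rat_cong p m (x ^ n) (y ^ n)"
  using assms by (induction n) (auto intro: rat_cong_refl rat_cong_mult p_integral_intros)

lemma rat_cong_sum:
  "(\<And>i. i \<in> A \<Longrightarrow> rat_cong p m (f i) (g i)) \<Longrightarrow> rat_cong p m (sum f A) (sum g A)"
  by (induction A rule: infinite_finite_induct) (auto intro: rat_cong_refl rat_cong_add)

lemma rat_cong_prod:
  assumes "\<And>i. i \<in> A \<Longrightarrow> rat_cong p m (f i) (g i)"
    and "\<And>i. i \<in> A \<Longrightarrow> f i \<in> p_integral p" and "\<And>i. i \<in> A \<Longrightarrow> g i \<in> p_integral p"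
  shows "rat_cong p m (prod f A) (prod g A)"
  using assms
  by (induction A rule: infinite_finite_induct)
    (auto intro!: rat_cong_refl rat_cong_mult p_integral_prod)

text \<open>The source of all gains in precision: a factor divisible by p^n raises the modulus of a
  congruence by p^n. In particular, a congruence modulo p becomes one modulo p^3 after
  multiplication by a quantity divisible by p^2.\<close>

lemma rat_cong_scale:
  assumes "rat_cong p n d 0" "rat_cong p m x y"
  shows "rat_cong p (n + m) (d * x) (d * y)"
proof -
  obtain z z' where "z \<in> p_integral p" "z' \<in> p_integral p"
    "d = of_nat p ^ n * z" "x = y + of_nat p ^ m * z'"
    using assms rat_cong_iff[of n d 0] rat_cong_iff[of m x y] by auto
  then show ?thesis
    by (intro rat_congI[of "z * z'"]) (auto intro: p_integral_intros simp: algebra_simps power_add)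
qed

lemma rat_cong_cancel:
  assumes "rat_cong p m (c * x) (c * y)" "1 / c \<in> p_integral p" "c \<noteq> 0"
  shows "rat_cong p m x y"
  using rat_cong_mult_left[OF assms(2,1)] assms(3) by simp

section \<open>Residues and units modulo p\<close>

lemma rat_cong_of_nat_0: "rat_cong p 1 (of_nat p) 0"
  by (rule rat_congI[OF p_integral_1]) simp

lemma rat_cong_of_int:
  assumes "[u = v] (mod int p)"
  shows "rat_cong p 1 (of_int u) (of_int v)"
proof -
  obtain k where "u = v + int p * k"
    using assms by (metis cong_iff_lin cong_sym)
  then show ?thesis
    by (intro rat_congI[OF p_integral_of_int[of k]]) simp
qed

lemma rat_cong_of_nat_0_iff: "rat_cong p 1 (of_nat n) 0 \<longleftrightarrow> p dvd n"
proof
  assume "rat_cong p 1 (of_nat n) 0"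
  then obtain z where z: "z \<in> p_integral p" "of_nat n = of_nat p * z"
    using rat_cong_iff[of 1 "of_nat n" 0] by auto
  obtain u v where uv: "z = of_int u / of_int v" "\<not> int p dvd v"
    using z(1) p_integral_iff[OF prime_p] by blast
  have "v \<noteq> 0" using uv(2) by auto
  then have "(of_int (int n * v) :: rat) = of_int (int p * u)"
    using z(2) uv(1) by (simp add: field_simps)
  then have "int n * v = int p * u" by (simp only: of_int_eq_iff)
  then have "int p dvd int n * v" by simp
  then show "p dvd n" using uv(2) prime_p by (simp add: prime_dvd_mult_iff)
next
  assume "p dvd n"
  then show "rat_cong p 1 (of_nat n) 0"
    using rat_cong_of_int[of "int n" 0] by (simp add: cong_0_iff)
qed

lemma not_rat_cong_0:
  assumes "rat_cong p 1 a (of_nat r)" "r \<in> {1..p-1}"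
  shows "\<not> rat_cong p 1 a 0"
proof
  assume "rat_cong p 1 a 0"
  then have "rat_cong p 1 (of_nat r) 0" using rat_cong_trans rat_cong_sym assms(1) by blast
  then have "p dvd r" by (simp only: rat_cong_of_nat_0_iff)
  then show False using assms(2) by (auto dest: dvd_imp_le)
qed

text \<open>A nonzero residue keeps p out of the numerator too, so numerator and denominator may
  trade places.\<close>

lemma p_integral_inverse:
  assumes "a \<in> p_integral p" "\<not> rat_cong p 1 a 0"
  shows "1 / a \<in> p_integral p"
proof -
  obtain u v where uv: "a = of_int u / of_int v" "\<not> int p dvd v"
    using assms(1) p_integral_iff[OF prime_p] by blast
  have "\<not> int p dvd u"
  proof
    assume "int p dvd u"
    then obtain k where "u = int p * k" by blast
    then have "a = 0 + of_nat p ^ 1 * (of_int k / of_int v)" using uv by simp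
    then have "rat_cong p 1 a 0"
      using uv(2) by (intro rat_congI[OF p_integralI]) auto
    then show False using assms(2) by blast
  qed
  then show ?thesis using uv by (intro p_integralI[of _ v u]) auto
qed

text \<open>Reduces to Fermat's theorem for the least residue of a.\<close>

lemma fermat_p_integral:
  assumes "a \<in> p_integral p" "\<not> rat_cong p 1 a 0"
  shows "rat_cong p 1 (a ^ (p - 1)) 1"
proof -
  obtain r where r: "rat_cong p 1 a (of_nat r)"
    using p_residue_exists1[OF prime_p assms(1)] by blast
  have "\<not> p dvd r"
    using rat_cong_of_nat_0_iff[of r] rat_cong_trans[OF r] assms(2) by blast
  then have "[r ^ (p - 1) = 1] (mod p)" by (rule fermat_theorem[OF prime_p])
  then have "[int (r ^ (p - 1)) = int 1] (mod int p)" by (simp only: cong_int_iff)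
  from rat_cong_of_int[OF this] have "rat_cong p 1 (of_nat r ^ (p - 1)) 1" by simp
  then show ?thesis
    using rat_cong_power[OF r assms(1) p_integral_of_nat] rat_cong_trans by blast
qed

section \<open>Harmonic sums and a truncated product\<close>

lemma p_integral_inverse_less: "i \<in> {1..p-1} \<Longrightarrow> 1 / of_nat i \<in> p_integral p"
  by (intro p_integral_inverse_of_nat) (auto dest: dvd_imp_le)

text \<open>Modulo \<open>p\<close> the map \<open>i \<mapsto> 2 i\<close> permutes the nonzero residues and multiplies
  the summand by \<open>1/4\<close>; and \<open>1 - 1/4\<close> is invertible because \<open>p > 3\<close>.\<close>

lemma harmonic_square_cong:
  assumes "p > 3"
  shows "rat_cong p 1 (\<Sum>i=1..p-1. 1 / of_nat i ^ 2) 0"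
proof -
  define j where "j i = (if 2 * i < p then 2 * i else 2 * i - p)" for i
  \<comment> \<open>Halving modulo p, the inverse of \<open>j\<close>: an odd i becomes even after
    adding the odd number p.\<close>
  define j' where "j' i = (if even i then i div 2 else (i + p) div 2)" for i
  let ?H = "\<Sum>i=1..p-1. 1 / (of_nat i :: rat) ^ 2"
  have odd: "odd p" using prime_p assms by (simp add: prime_odd_nat)
  have j: "j i \<in> {1..p-1}" if "i \<in> {1..p-1}" for i
    using that odd unfolding j_def by auto presburger+
  have summand: "rat_cong p 1 (1 / of_nat (j i) ^ 2) (1 / 4 * (1 / of_nat i ^ 2))"
    if "i \<in> {1..p-1}" for i
  proof -
    have i: "i > 0" "j i > 0" using that j[OF that] by auto
    have c: "rat_cong p 1 (of_nat (j i)) (2 * of_nat i)"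
    proof (cases "2 * i < p")
      case True
      then show ?thesis by (simp add: j_def rat_cong_refl)
    next
      case False
      then show ?thesis
        by (intro rat_congI[OF p_integral_of_int[of "-1"]]) (simp add: j_def of_nat_diff)
    qed
    have "rat_cong p 1 (of_nat (j i) ^ 2) ((2 * of_nat i) ^ 2)"
      by (intro rat_cong_power c p_integral_intros)
    \<comment> \<open>Multiplying by the inverses of both squares turns the congruence of the
      squares into one of their reciprocals, with the sides exchanged.\<close>
    then have *: "rat_cong p 1 (1 / of_nat (2 * i) ^ 2 * (1 / of_nat (j i) ^ 2) * of_nat (j i) ^ 2)
      (1 / of_nat (2 * i) ^ 2 * (1 / of_nat (j i) ^ 2) * (2 * of_nat i) ^ 2)"
    proof (intro rat_cong_mult_left p_integral_mult)
      have "\<not> p dvd 2 * i"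
        using that prime_p assms by (auto simp: prime_dvd_mult_iff dest: dvd_imp_le)
      then show "1 / of_nat (2 * i) ^ 2 \<in> p_integral p"
        using p_integral_power[OF p_integral_inverse_of_nat[of "2 * i"], of 2]
        by (simp add: power_divide)
      show "1 / of_nat (j i) ^ 2 \<in> p_integral p"
        using p_integral_power[OF p_integral_inverse_less[OF j[OF that]], of 2]
        by (simp add: power_divide)
    qed
    have "1 / of_nat (2 * i) ^ 2 * (1 / of_nat (j i) ^ 2) * of_nat (j i) ^ 2
        = 1 / 4 * (1 / (of_nat i :: rat) ^ 2)"
      "1 / of_nat (2 * i) ^ 2 * (1 / of_nat (j i) ^ 2) * (2 * of_nat i) ^ 2
        = 1 / (of_nat (j i) :: rat) ^ 2"
      using i by (simp_all add: field_simps)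
    then show ?thesis using rat_cong_sym[OF *] by simp
  qed
  have "?H = (\<Sum>i=1..p-1. 1 / of_nat (j i) ^ 2)"
    using odd
    by (intro sum.reindex_bij_witness[of _ j j'])
      (auto simp: j_def j'_def, presburger+)
  also have "rat_cong p 1 \<dots> (\<Sum>i=1..p-1. 1 / 4 * (1 / of_nat i ^ 2))"
    by (intro rat_cong_sum summand)
  also have "\<dots> = 1 / 4 * ?H" by (simp only: sum_distrib_left)
  finally have "rat_cong p 1 (?H - 1 / 4 * ?H) (1 / 4 * ?H - 1 / 4 * ?H)"
    by (intro rat_cong_diff rat_cong_refl)
  \<comment> \<open>Clearing the 4 leaves only 3 to be inverted, which p > 3 allows.\<close>
  then have "rat_cong p 1 (4 * (3 / 4 * ?H)) (4 * 0)"
    by (intro rat_cong_mult_left p_integral_intros) simp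
  then have "rat_cong p 1 (3 * ?H) (3 * 0)" by simp
  moreover have "1 / 3 \<in> p_integral p"
    using p_integral_inverse_of_nat[of 3] assms by (simp add: nat_dvd_not_less)
  ultimately show ?thesis by (rule rat_cong_cancel) simp
qed

text \<open>Pairing i with p - i gives 1/i + 1/(p - i) = p / (i (p - i)), which supplies one factor
  p. Modulo p the cofactor is -1/i^2, so \<open>harmonic_square_cong\<close> supplies the
  second.\<close>

lemma harmonic_cong:
  assumes "p > 3"
  shows "rat_cong p 2 (\<Sum>i=1..p-1. 1 / of_nat i) 0"
proof -
  let ?H = "\<Sum>i=1..p-1. 1 / (of_nat i :: rat)"
  have "?H = (\<Sum>i=1..p-1. 1 / of_nat (p - i))"
    by (intro sum.reindex_bij_witness[of _ "\<lambda>i. p - i" "\<lambda>i. p - i"]) auto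
  then have "2 * ?H = (\<Sum>i=1..p-1. 1 / of_nat i + 1 / of_nat (p - i))"
    by (simp add: sum.distrib)
  also have "\<dots> = (\<Sum>i=1..p-1. of_nat p * (1 / of_nat i * (1 / of_nat (p - i))))"
    by (intro sum.cong) (auto simp: of_nat_diff field_simps)
  also have "\<dots> = of_nat p * (\<Sum>i=1..p-1. 1 / of_nat i * (1 / of_nat (p - i)))"
    by (simp only: sum_distrib_left)
  finally have eq: "2 * ?H = of_nat p * (\<Sum>i=1..p-1. 1 / of_nat i * (1 / of_nat (p - i)))" .
  have summand: "rat_cong p 1 (1 / of_nat i * (1 / of_nat (p - i))) (- (1 / of_nat i ^ 2))"
    if "i \<in> {1..p-1}" for i
  proof (rule rat_congI)
    show "1 / of_nat i * (1 / of_nat i) * (1 / of_nat (p - i)) \<in> p_integral p"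
      using that by (intro p_integral_mult p_integral_inverse_less) auto
    show "1 / of_nat i * (1 / of_nat (p - i)) = - (1 / of_nat i ^ 2)
        + of_nat p ^ 1 * (1 / of_nat i * (1 / of_nat i) * (1 / (of_nat (p - i) :: rat)))"
      using that by (auto simp: of_nat_diff field_simps power2_eq_square)
  qed
  have "rat_cong p 1 (\<Sum>i=1..p-1. 1 / of_nat i * (1 / of_nat (p - i)))
      (\<Sum>i=1..p-1. - (1 / of_nat i ^ 2))"
    by (intro rat_cong_sum summand)
  also have "(\<Sum>i=1..p-1. - (1 / of_nat i ^ 2)) = - (\<Sum>i=1..p-1. 1 / (of_nat i :: rat) ^ 2)"
    by (simp only: sum_negf)
  also have "rat_cong p 1 \<dots> (- 0)"
    by (intro rat_cong_uminus harmonic_square_cong assms)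
  finally have "rat_cong p (1 + 1) (2 * ?H) (of_nat p * (- 0))"
    unfolding eq by (intro rat_cong_scale rat_cong_of_nat_0)
  then have "rat_cong p 2 (2 * ?H) (2 * 0)" by (simp add: numeral_2_eq_2)
  moreover have "1 / 2 \<in> p_integral p"
    using p_integral_inverse_of_nat[of 2] assms by (simp add: nat_dvd_not_less)
  ultimately show ?thesis by (rule rat_cong_cancel) simp
qed

text \<open>Modulo \<open>p\<close>, the numbers \<open>i - a\<close> with \<open>0 \<le> i < p\<close> and \<open>i \<noteq> r\<close> run through the
  nonzero residues, so their product cancels the denominator \<open>(p - 1)!\<close>; the factor
  \<open>i = 0\<close> accounts for \<open>1 / a\<close>.\<close>

lemma prod_one_minus_cong:
  assumes a: "a \<in> p_integral p" and r: "rat_cong p 1 a (of_nat r)" "r \<in> {1..p-1}"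
  obtains w where "(\<Prod>i=1..p-1. 1 - a / of_nat i) = (a - of_nat r) * w"
    "rat_cong p 1 w (1 / a)" "w \<in> p_integral p"
proof -
  define A where "A = {1..p-1} - {r}"
  \<comment> \<open>\<open>j\<close> is the least residue of i - r, and \<open>j'\<close> adds r
    back modulo p.\<close>
  define j where "j i = (if i < r then i + p - r else i - r)" for i
  define j' where "j' i = (if i + r < p then i + r else i + r - p)" for i
  define c where "c = (\<Prod>i=1..p-1. 1 / (of_nat i :: rat))"
  \<comment> \<open>The minus sign turns the extracted factor r - a, at i = r, into a - r.\<close>
  define w where "w = - (c * (\<Prod>i\<in>A. of_nat i - a))"
  have p: "p > 1" using prime_p prime_gt_1_nat by blast
  have c: "c \<in> p_integral p"
    unfolding c_def by (intro p_integral_prod p_integral_inverse_less)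
  have c1: "c * (\<Prod>i=1..p-1. of_nat i) = 1"
    unfolding c_def prod.distrib[symmetric] by (intro prod.neutral) auto
  have a0: "\<not> rat_cong p 1 a 0" by (rule not_rat_cong_0[OF r])
  have "a \<noteq> 0" using a0 rat_cong_refl by blast
  have "(\<Prod>i=1..p-1. 1 - a / of_nat i) = (\<Prod>i=1..p-1. 1 / of_nat i * (of_nat i - a))"
    by (intro prod.cong) (auto simp: field_simps)
  also have "\<dots> = c * (\<Prod>i=1..p-1. of_nat i - a)"
    by (simp only: prod.distrib c_def)
  also have "(\<Prod>i=1..p-1. of_nat i - a) = (of_nat r - a) * (\<Prod>i\<in>A. of_nat i - a)"
    unfolding A_def using r(2) by (intro prod.remove) auto
  finally have "(\<Prod>i=1..p-1. 1 - a / of_nat i) = (a - of_nat r) * w"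
    by (simp add: w_def algebra_simps)
  moreover have w: "w \<in> p_integral p"
    unfolding w_def using a c by (intro p_integral_intros)
  moreover have "rat_cong p 1 w (1 / a)"
  proof (rule rat_cong_cancel)
    \<comment> \<open>In a * w the minus sign of \<open>w\<close> and the multiplier a form the
      factor 0 - a at i = 0, so the product now runs over all residues except r.\<close>
    have "insert 0 A = {0..p-1} - {r}" "0 \<notin> A" "finite A"
      using r(2) by (auto simp: A_def)
    then have "a * w = c * (\<Prod>i\<in>{0..p-1} - {r}. of_nat i - a)"
      using prod.insert[of A 0 "\<lambda>i. of_nat i - a"] by (simp add: w_def)
    also have "rat_cong p 1 \<dots> (c * (\<Prod>i\<in>{0..p-1} - {r}. of_nat (j i)))"
    proof (intro rat_cong_mult_left c rat_cong_prod p_integral_intros a)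
      fix i assume i: "i \<in> {0..p-1} - {r}"
      have "rat_cong p 1 (of_nat i - a) (of_nat i - of_nat r)"
        by (intro rat_cong_diff r rat_cong_refl)
      also have "rat_cong p 1 \<dots> (of_nat (j i))"
      proof (cases "i < r")
        case True
        with r(2) p show ?thesis
          by (intro rat_congI[OF p_integral_of_int[of "-1"]]) (auto simp: j_def of_nat_diff)
      next
        case False
        then show ?thesis by (simp add: j_def of_nat_diff rat_cong_refl)
      qed
      finally show "rat_cong p 1 (of_nat i - a) (of_nat (j i))" .
    qed
    also have "(\<Prod>i\<in>{0..p-1} - {r}. (of_nat (j i) :: rat)) = (\<Prod>i=1..p-1. of_nat i)"
      using r(2) p
      by (intro prod.reindex_bij_witness[of _ j' j]) (auto simp: j_def j'_def)
    also have "c * \<dots> = a * (1 / a)"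
      using c1 \<open>a \<noteq> 0\<close> by simp
    finally show "rat_cong p 1 (a * w) (a * (1 / a))" .
  qed (use a a0 \<open>a \<noteq> 0\<close> p_integral_inverse in auto)
  ultimately show thesis using that by blast
qed

text \<open>The coefficients have only powers of 2 as denominators, and 2 is a unit since p >
  2.\<close>

lemma euler_polynomial_cong:
  assumes "p > 2" "x \<in> p_integral p" "y \<in> p_integral p" "rat_cong p m x y"
  shows "rat_cong p m (euler_polynomial n x) (euler_polynomial n y)"
proof -
  have "\<not> p dvd 2" using assms(1) by (auto dest: dvd_imp_le)
  then have "1 / 2 ^ n \<in> p_integral p"
    using p_integral_power[OF p_integral_inverse_of_nat[of 2], of n]
    by (simp add: power_divide)
  then show ?thesis
    unfolding euler_polynomial_def
    by (intro rat_cong_mult_left rat_cong_sum rat_cong_mult rat_cong_power rat_cong_diff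
        rat_cong_refl p_integral_intros assms)
qed

section \<open>The congruence\<close>

text \<open>Since p divides b, the product in \<open>gchoose_mult_gchoose\<close> is 1 modulo p^2,
  and its prefactor contains a further b. Modulo p^3 the sum is therefore 1 - b^2 H_2 - b H_1, where
  H_m is the sum of 1/k^m over 0 < k < p.\<close>

lemma sum_gchoose_cong_0:
  assumes p: "p > 3" and b: "rat_cong p 1 b 0"
  shows "rat_cong p 3 (\<Sum>k=0..p-1. (b gchoose k) * ((-1 - b) gchoose k)) 1"
proof -
  let ?H = "\<lambda>m. \<Sum>k=1..p-1. 1 / (of_nat k :: rat) ^ m"
  obtain z where z: "z \<in> p_integral p" "b = of_nat p * z"
    using b rat_cong_iff[of 1 b 0] by auto
  have bZ: "b \<in> p_integral p" using z p_integral_intros by simp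
  have b2: "rat_cong p 2 (b ^ 2) 0"
    using z by (intro rat_congI[of "z ^ 2"]) (auto intro: p_integral_intros simp: power_mult_distrib)
  have inv: "1 / of_nat k ^ m \<in> p_integral p" if "k \<in> {1..p-1}" for k m
    using p_integral_power[OF p_integral_inverse_less[OF that], of m]
    by (simp add: power_divide)
  have summand: "rat_cong p 3 ((b gchoose k) * ((-1 - b) gchoose k))
      (- (b ^ 2 * (1 / of_nat k ^ 2)) - b * (1 / of_nat k ^ 1))"
    if k: "k \<in> {1..p-1}" for k
  proof -
    obtain j where j: "k = Suc j" using k by (cases k) auto
    let ?P = "\<Prod>i=1..j. 1 - b ^ 2 / of_nat i ^ 2"
    have "rat_cong p 2 ?P (\<Prod>i=1..j. 1 - 0)"
    proof (intro rat_cong_prod rat_cong_diff rat_cong_refl)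
      fix i assume "i \<in> {1..j}"
      then have i: "1 / of_nat i ^ 2 \<in> p_integral p" using inv[of i 2] k j by auto
      show "rat_cong p 2 (b ^ 2 / of_nat i ^ 2) 0"
        using rat_cong_mult_left[OF i b2] by simp
      show "1 - b ^ 2 / of_nat i ^ 2 \<in> p_integral p"
        using p_integral_diff[OF p_integral_1 p_integral_mult[OF p_integral_power[OF bZ, of 2] i]]
        by simp
    qed (auto intro: p_integral_intros)
    then have "rat_cong p (1 + 2) (b * ?P) (b * 1)"
      by (intro rat_cong_scale b) simp
    then have P: "rat_cong p 3 (b * ?P) (b * 1)" by (simp only: one_plus_numeral semiring_norm)
    have "rat_cong p 3 (- ((b + of_nat k) * (1 / of_nat k ^ 2)) * (b * ?P))
       (- ((b + of_nat k) * (1 / of_nat k ^ 2)) * (b * 1))"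
      using inv[OF k] bZ by (intro rat_cong_mult_left[OF _ P] p_integral_intros)
    moreover have "- ((b + of_nat k) * (1 / of_nat k ^ 2)) * (b * ?P) = (b gchoose k) * ((-1 - b) gchoose k)"
      unfolding j gchoose_mult_gchoose by (simp add: mult_ac)
    moreover have "- ((b + of_nat k) * (1 / of_nat k ^ 2)) * (b * 1)
       = - (b ^ 2 * (1 / of_nat k ^ 2)) - b * (1 / of_nat k ^ 1)"
      using k by (simp add: field_simps power2_eq_square)
    ultimately show ?thesis by simp
  qed
  have "(\<Sum>k=0..p-1. (b gchoose k) * ((-1 - b) gchoose k))
     = 1 + (\<Sum>k=1..p-1. (b gchoose k) * ((-1 - b) gchoose k))"
    by (subst sum.atLeast_Suc_atMost) auto
  also have "rat_cong p 3 \<dots> (1 + (\<Sum>k=1..p-1. - (b ^ 2 * (1 / of_nat k ^ 2)) - b * (1 / of_nat k ^ 1)))"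
    by (intro rat_cong_add rat_cong_sum rat_cong_refl summand)
  also have "\<dots> = 1 - b ^ 2 * ?H 2 - b * ?H 1"
    by (simp only: sum_subtractf sum_negf sum_distrib_left)
  also have "rat_cong p 3 \<dots> (1 - 0 - 0)"
  proof (intro rat_cong_diff rat_cong_refl)
    \<comment> \<open>The exponent 3 arises as 2 + 1 here and as 1 + 2 in the next claim.\<close>
    show "rat_cong p 3 (b ^ 2 * ?H 2) 0"
      using rat_cong_scale[OF b2 harmonic_square_cong[OF p]] by simp
    show "rat_cong p 3 (b * ?H 1) 0"
      using rat_cong_scale[OF b harmonic_cong[OF p]] by (simp add: numeral_3_eq_3)
  qed
  finally show ?thesis by simp
qed

section \<open>The factor divisible by p^2 and the inhomogeneous term of the recurrence\<close>

lemma residue_product_cong: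
  assumes "rat_cong p 1 a (of_nat r)"
  shows "rat_cong p 2 ((a - of_nat r) * (of_nat p + a - of_nat r)) 0"
proof -
  \<comment> \<open>With a = r + p z the two factors are p z and p (1 + z).\<close>
  obtain z where z: "z \<in> p_integral p" "a = of_nat r + of_nat p * z"
    using assms rat_cong_iff[of 1 a "of_nat r"] by auto
  then show ?thesis
    by (intro rat_congI[of "z * (1 + z)"] p_integral_intros)
      (auto simp: algebra_simps power2_eq_square)
qed

text \<open>Splitting each factor into (1 - a/i)(1 + a/i) gives two products of the previous kind,
  for a with residue r and for -a with residue p - r. Their linear factors multiply to -D and their
  cofactors to -1/a^2 modulo p.\<close>

lemma prod_one_minus_square_cong:
  assumes a: "a \<in> p_integral p"
    and r: "rat_cong p 1 a (of_nat r)" "r \<in> {1..p-1}"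
  shows "rat_cong p 3 (\<Prod>i=1..p-1. 1 - a ^ 2 / of_nat i ^ 2)
    ((a - of_nat r) * (of_nat p + a - of_nat r) * (1 / a ^ 2))"
proof -
  let ?D = "(a - of_nat r) * (of_nat p + a - of_nat r)"
  have r': "p - r \<in> {1..p-1}" using r(2) by auto
  obtain z where z: "z \<in> p_integral p" "a = of_nat r + of_nat p * z"
    using r(1) rat_cong_iff[of 1 a "of_nat r"] by auto
  \<comment> \<open>The witness comes from -a = -r - p z = (p - r) + p (-z - 1).\<close>
  have "rat_cong p 1 (- a) (of_nat (p - r))"
    using z r(2) by (intro rat_congI[of "- z - 1"] p_integral_intros)
      (auto simp: of_nat_diff algebra_simps)
  then obtain w' where w': "(\<Prod>i=1..p-1. 1 - - a / of_nat i) = (- a - of_nat (p - r)) * w'"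
    "rat_cong p 1 w' (1 / - a)" "w' \<in> p_integral p"
    using prod_one_minus_cong[OF p_integral_uminus[OF a] _ r'] by blast
  obtain w where w: "(\<Prod>i=1..p-1. 1 - a / of_nat i) = (a - of_nat r) * w"
    "rat_cong p 1 w (1 / a)" "w \<in> p_integral p"
    using prod_one_minus_cong[OF a r] by blast
  have "(\<Prod>i=1..p-1. 1 - a ^ 2 / of_nat i ^ 2)
     = (\<Prod>i=1..p-1. (1 - a / of_nat i) * (1 - - a / of_nat i))"
    by (intro prod.cong) (auto simp: algebra_simps power2_eq_square)
  also have "\<dots> = ?D * (- (w * w'))"
    using r(2) by (simp only: prod.distrib w(1) w'(1)) (auto simp: of_nat_diff algebra_simps)
  finally have eq: "(\<Prod>i=1..p-1. 1 - a ^ 2 / of_nat i ^ 2) = ?D * (- (w * w'))" .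
  have "1 / a \<in> p_integral p"
    by (intro p_integral_inverse a not_rat_cong_0[OF r])
  then have "rat_cong p 1 (- (w * w')) (- (1 / a * (1 / - a)))"
    using w w' by (intro rat_cong_uminus rat_cong_mult)
  then have "rat_cong p (2 + 1) (?D * (- (w * w'))) (?D * (- (1 / a * (1 / - a))))"
    by (intro rat_cong_scale residue_product_cong r)
  then show ?thesis unfolding eq by (simp add: power2_eq_square)
qed

text \<open>Fermat's theorem divided by a^2.\<close>

lemma power_minus_3_cong:
  assumes "p > 3" "a \<in> p_integral p" "\<not> rat_cong p 1 a 0"
  shows "rat_cong p 1 (a ^ (p - 3)) (1 / a ^ 2)"
proof (rule rat_cong_cancel)
  have "a \<noteq> 0" using assms(3) rat_cong_refl by blast
  moreover have "p - 1 = 2 + (p - 3)" using assms(1) by simp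
  ultimately show "rat_cong p 1 (a ^ 2 * a ^ (p - 3)) (a ^ 2 * (1 / a ^ 2))"
    using fermat_p_integral[OF assms(2,3)] by (simp only: power_add) simp
  show "1 / a ^ 2 \<in> p_integral p"
    using p_integral_power[OF p_integral_inverse[OF assms(2,3)], of 2] by (simp add: power_divide)
  show "a ^ 2 \<noteq> 0" using \<open>a \<noteq> 0\<close> by simp
qed

lemma sum_gchoose_cong_euler_polynomial:
  assumes p: "p > 3" and "r < p" "a \<in> p_integral p" "rat_cong p 1 a (of_nat r)"
  shows "rat_cong p 3 (\<Sum>k=0..p-1. (a gchoose k) * ((-1 - a) gchoose k))
    ((-1) ^ r + (a - of_nat r) * (of_nat p + a - of_nat r) * euler_polynomial (p - 3) (- a))"
  using assms(2-)
\<comment> \<open>The step passes from a to a - 1, whose residue is r, so a must be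
  arbitrary.\<close>
proof (induction r arbitrary: a)
  case 0
  let ?E = "euler_polynomial (p - 3)"
  have a: "rat_cong p 1 a 0" using 0 by simp
  have "odd p" using prime_p p by (simp add: prime_odd_nat)
  then have E0: "?E 0 = 0" using p by (intro euler_polynomial_0) auto
  have "rat_cong p 1 (- a) 0" using rat_cong_uminus[OF a] by simp
  \<comment> \<open>Knowing the Euler polynomial modulo p suffices, since its multiplier is
    divisible by p^2.\<close>
  then have "rat_cong p 1 (?E (- a)) (?E 0)"
    using p 0 by (intro euler_polynomial_cong p_integral_intros) auto
  then have "rat_cong p (2 + 1) ((a - of_nat 0) * (of_nat p + a - of_nat 0) * ?E (- a))
      ((a - of_nat 0) * (of_nat p + a - of_nat 0) * ?E 0)"
    by (intro rat_cong_scale residue_product_cong 0)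
  then have "rat_cong p 3 (1 + (a - of_nat 0) * (of_nat p + a - of_nat 0) * ?E (- a)) (1 + 0)"
    using E0 by (intro rat_cong_add rat_cong_refl) simp
  then show ?case
    using rat_cong_trans[OF sum_gchoose_cong_0[OF p a] rat_cong_sym] by simp
next
  case (Suc r)
  let ?E = "euler_polynomial (p - 3)"
  let ?S = "\<lambda>a. \<Sum>k=0..p-1. (a gchoose k) * ((-1 - a) gchoose k)"
  let ?P = "\<Prod>i=1..p-1. 1 - a ^ 2 / of_nat i ^ 2"
  define D where "D = (a - of_nat (Suc r)) * (of_nat p + a - of_nat (Suc r))"
  have r: "Suc r \<in> {1..p-1}" using Suc.prems by auto
  have D: "rat_cong p 2 D 0" unfolding D_def by (intro residue_product_cong Suc.prems)
  have "rat_cong p 1 (a - 1) (of_nat (Suc r) - 1)"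
    by (intro rat_cong_diff Suc.prems rat_cong_refl)
  then have IH: "rat_cong p 3 (?S (a - 1)) ((-1) ^ r + (a - 1 - of_nat r) * (of_nat p + (a - 1) - of_nat r) * ?E (- (a - 1)))"
    using Suc.prems by (intro Suc.IH p_integral_intros) auto
  \<comment> \<open>Returning to the power a^(p - 3) makes the shift identity of the Euler
    polynomial applicable.\<close>
  have "rat_cong p 1 (1 / a ^ 2) (a ^ (p - 3))"
    by (rule rat_cong_sym) (intro power_minus_3_cong p Suc.prems not_rat_cong_0[OF _ r])
  then have "rat_cong p (2 + 1) (D * (1 / a ^ 2)) (D * a ^ (p - 3))"
    by (intro rat_cong_scale D)
  then have "rat_cong p 3 ?P (D * a ^ (p - 3))"
    using rat_cong_trans[OF prod_one_minus_square_cong[OF Suc.prems(2,3) r]]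
    unfolding D_def by simp
  then have "rat_cong p 3 (2 * ?P) (2 * (D * a ^ (p - 3)))"
    by (intro rat_cong_mult_left p_integral_intros)
  then have "rat_cong p 3 (2 * ?P - ?S (a - 1))
     (2 * (D * a ^ (p - 3)) - ((-1) ^ r + (a - 1 - of_nat r) * (of_nat p + (a - 1) - of_nat r) * ?E (- (a - 1))))"
    by (intro rat_cong_diff IH)
  also have "2 * ?P - ?S (a - 1) = ?S a"
    unfolding sum_gchoose_recurrence[symmetric] by simp
  also have "2 * (D * a ^ (p - 3)) - ((-1) ^ r + (a - 1 - of_nat r) * (of_nat p + (a - 1) - of_nat r) * ?E (- (a - 1)))
     = (-1) ^ Suc r + D * ?E (- a)"
  proof -
    \<comment> \<open>Evenness identifies (-a)^(p - 3) with a^(p - 3), so the shift identity at -a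
      replaces E(1 - a) by -E(-a). Since \<open>D\<close> depends only on the difference of a and
      its residue, it is common to both stages.\<close>
    have "even (p - 3)" using prime_p p prime_odd_nat[of p] by auto
    then have "2 * a ^ (p - 3) = ?E (- a + 1) + ?E (- a)"
      unfolding euler_polynomial_shift by (simp add: power_minus_even)
    then have "2 * (D * a ^ (p - 3)) = D * (?E (- a + 1) + ?E (- a))"
      by (metis mult.left_commute)
    moreover have "(a - 1 - of_nat r) * (of_nat p + (a - 1) - of_nat r) = D"
      by (simp add: D_def algebra_simps)
    moreover have "- (a - 1) = - a + 1" by simp
    ultimately show ?thesis by (simp only: power_Suc) (simp add: algebra_simps)
  qed
  finally show ?case unfolding D_def .
qed

text \<open>Reflection gives E(-a) = E(1 + a), and the shift identity turns this into 2 a^(p - 3) -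
  E(a).\<close>

lemma euler_polynomial_minus_cong:
  assumes "p > 3" "a \<in> p_integral p" "\<not> rat_cong p 1 a 0"
  shows "rat_cong p 1 (euler_polynomial (p - 3) (- a)) (2 / a ^ 2 - euler_polynomial (p - 3) a)"
proof -
  let ?E = "euler_polynomial (p - 3)"
  have "even (p - 3)" using prime_p assms(1) prime_odd_nat[of p] by auto
  then have "?E (- a) = 2 * a ^ (p - 3) - ?E a"
    using euler_polynomial_shift[of "p - 3" a] euler_polynomial_reflect[of "p - 3" "- a"]
    by (simp add: add.commute)
  also have "rat_cong p 1 \<dots> (2 * (1 / a ^ 2) - ?E a)"
    by (intro rat_cong_diff rat_cong_mult_left rat_cong_refl power_minus_3_cong p_integral_intros assms)
  finally show ?thesis by simp
qed

end

theorem theorem2p1: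
  fixes p :: nat and a t :: rat
  assumes "prime p" and "p > 3"
    and "a \<in> p_integral p" and "\<not> rat_cong p 1 a 0"
    and "t = (a - of_nat (p_residue p a)) / of_nat p"
  shows "rat_cong p 3
           (\<Sum>k=0..p-1. (a gchoose k) * ((-1 - a) gchoose k))
           ((-1) ^ p_residue p a
             + (a - of_nat (p_residue p a)) * (of_nat p + a - of_nat (p_residue p a))
               * euler_polynomial (p - 3) (- a))
       \<and> rat_cong p 3
           (\<Sum>k=0..p-1. (a gchoose k) * ((-1 - a) gchoose k))
           ((-1) ^ p_residue p a
             + (a - of_nat (p_residue p a)) * (of_nat p + a - of_nat (p_residue p a))
               * (2 / a\<^sup>2 - euler_polynomial (p - 3) a))
       \<and> (a - of_nat (p_residue p a)) * (of_nat p + a - of_nat (p_residue p a))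
           = of_nat p ^ 2 * t * (t + 1)"
proof (intro conjI)
  let ?r = "p_residue p a"
  let ?D = "(a - of_nat ?r) * (of_nat p + a - of_nat ?r)"
  let ?E = "euler_polynomial (p - 3)"
  \<comment> \<open>Unique existence makes the definite description in \<open>p_residue\<close>
    meaningful.\<close>
  have "?r \<in> {0..p-1} \<and> rat_cong p 1 a (of_nat ?r)"
    unfolding p_residue_def using p_residue_exists1[OF assms(1,3)] by (rule theI')
  then have r: "?r < p" "rat_cong p 1 a (of_nat ?r)" using assms(2) by auto
  note cong = sum_gchoose_cong_euler_polynomial[OF assms(1,2) r(1) assms(3) r(2)]
  show "rat_cong p 3 (\<Sum>k=0..p-1. (a gchoose k) * ((-1 - a) gchoose k))
     ((-1) ^ ?r + ?D * ?E (- a))"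
    by (rule cong)
  \<comment> \<open>\<open>?D\<close> contributes p^2, so the two Euler polynomial expressions need
    only agree modulo p.\<close>
  have "rat_cong p (2 + 1) (?D * ?E (- a)) (?D * (2 / a\<^sup>2 - ?E a))"
    by (intro rat_cong_scale residue_product_cong euler_polynomial_minus_cong assms r)
  then have "rat_cong p 3 ((-1) ^ ?r + ?D * ?E (- a)) ((-1) ^ ?r + ?D * (2 / a\<^sup>2 - ?E a))"
    by (intro rat_cong_add rat_cong_refl assms) simp
  with cong show "rat_cong p 3 (\<Sum>k=0..p-1. (a gchoose k) * ((-1 - a) gchoose k))
     ((-1) ^ ?r + ?D * (2 / a\<^sup>2 - ?E a))"
    by (rule rat_cong_trans[OF assms(1)])
  have "a - of_nat ?r = of_nat p * t" using assms(2,5) by simp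
  moreover have "of_nat p + a - of_nat ?r = of_nat p + (a - of_nat ?r)" by simp
  ultimately show "?D = of_nat p ^ 2 * t * (t + 1)"
    by (simp only:) (simp add: algebra_simps power2_eq_square)
qed

end
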